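(* Let $\mathbf{S}$ be a canonical single-parameter exponential family with open mean range $\mathbf{O}=(\underline{\mu},\overline{\mu})$ and divergence $d(\cdot,\cdot)$. Let $\nu\in\mathbf{S}$ have mean $\mu$, let $N_\delta\to\infty$ as $\delta\to0$, and let $\pi\in\Pi^s_{\rm CI_L}$ be any stable one-sided confidence-interval policy, with limiting left endpoint $\mu_L^\pi(\mu)\le\mu$. Then: 1. (No learning regime) If $\lim_{\delta\to0}\frac{N_\delta}{\log(1/\delta)}=0$, then $\mu-\widehat\mu_L^\pi(N_\delta,\delta)\overset{p}{\to}\mu-\underline\mu$ as $\delta\to0$. 2. (Sufficient learning regime) If $\lim_{\delta\to0}\frac{N_\delta}{\log(1/\delta)}=k$ with $k\in(0,\infty)$, then $\mu-\mu_L^\pi(\mu)\ge\mu-\mu_L^*(\mu,k)$, where $\mu_L^*(\mu,k)<\mu$ uniquely solves $d(\mu,\mu_L^*(\mu,k))=\frac1k$.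
   Context: Exponential family. Fix a reference measure $\xi$ on $\mathbb{R}$. $\mathbf{S}=\{p_\theta:\theta\in\Theta\}$, with $\frac{dp_\theta}{d\xi}(x)=\exp(\theta x-b(\theta))$, where $\Theta=\{\theta\in\mathbb{R}:\int|x|e^{\theta x}\,d\xi(x)<\infty\}$ is assumed to be an open interval, and $b$ is a known, twice differentiable, strictly convex function. The mean of $p_\theta$ is $b'(\theta)$, strictly increasing in $\theta$; its inverse is $\mu\mapsto\theta(\mu)$. The set of means (the "support of the mean") is the open interval $\mathbf{O}=(\underline\mu,\overline\mu)$. For $\mu,\tilde\mu\in\mathbf{O}$, $d(\mu,\tilde\mu)=KL(p_{\theta(\mu)},p_{\theta(\tilde\mu)})=b(\theta(\tilde\mu))-b(\theta(\mu))-b'(\theta(\mu))(\theta(\tilde\mu)-\theta(\mu))$, where $KL$ is the Kullback–Leibler divergence. One-sided policies. $X_1,X_2,\dots$ are i.i.d. from $\nu$; $\mathbb{P}_\nu$ is the corresponding probability. A one-sided policy $\pi$ assigns to each $n\in\mathbb{N}$ and $\delta\in(0,1)$ an interval $[\widehat\mu_L^\pi(n,\delta),\overline\mu)$ whose left endpoint is computed from $X_1,\dots,X_n$. $N_\delta$ is the sample size as a function of $\delta\in(0,1)$. $\Pi^s_{\rm CI_L}$ is the set of one-sided policies such that (i) for every $\nu\in\mathbf{S}$ with mean $\mu$, every $\delta\in(0,1)$ and every $n\in\mathbb{N}$, $\mathbb{P}_\nu(\mu\in[\widehat\mu_L^\pi(n,\delta),\overline\mu))\ge1-\delta$; and (ii)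 (stability, for the given $\nu$ with mean $\mu$) as $\delta\to0$, under $\mathbb{P}_\nu$, $\widehat\mu_L^\pi(N_\delta,\delta)\overset{p}{\to}\mu_L^\pi(\mu)$, where $\mu_L^\pi(\mu)\le\mu$ is a constant ($-\infty$ allowed). The quantity $\mu-\mu_L^\pi(\mu)$ is the "half-width" of the one-sided interval.
   Formalization: The left endpoint is required to be at least underline μ (else part 1 fails). A solution of d(μ,m)=1/k can fail to exist; existence is claimed only if d(μ,m)≥1/k for some m<μ in O, and otherwise μ_L^*(μ,k) is set to underline μ. *)

theory Defs
  imports "HOL-Probability.Probability"
begin

definition natural_params :: "real measure \<Rightarrow> real set" where
  "natural_params \<xi> = {\<theta>. integrable \<xi> (\<lambda>x. \<bar>x\<bar> * exp (\<theta> * x))}"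

definition exp_dist :: "real measure \<Rightarrow> (real \<Rightarrow> real) \<Rightarrow> real \<Rightarrow> real measure" where
  "exp_dist \<xi> b \<theta> = density \<xi> (\<lambda>x. ennreal (exp (\<theta> * x - b \<theta>)))"

definition exp_family :: "real measure \<Rightarrow> (real \<Rightarrow> real) \<Rightarrow> real measure set" where
  "exp_family \<xi> b = exp_dist \<xi> b ` natural_params \<xi>"

definition strictly_convex_on :: "real set \<Rightarrow> (real \<Rightarrow> real) \<Rightarrow> bool" where
  "strictly_convex_on S f \<longleftrightarrow> convex S \<and>
     (\<forall>x\<in>S. \<forall>y\<in>S. \<forall>t. x \<noteq> y \<and> 0 < t \<and> t < 1 \<longrightarrow>
        f ((1 - t) * x + t * y) < (1 - t) * f x + t * f y)"

(* That the densities integrate to one makes b the log-partition function on the natural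
   parameter set; the values of b elsewhere are irrelevant. *)
definition canonical_exp_family :: "real measure \<Rightarrow> (real \<Rightarrow> real) \<Rightarrow> bool" where
  "canonical_exp_family \<xi> b \<longleftrightarrow>
     sets \<xi> = sets borel \<and>
     open (natural_params \<xi>) \<and> is_interval (natural_params \<xi>) \<and>
     (\<forall>\<theta>\<in>natural_params \<xi>. prob_space (exp_dist \<xi> b \<theta>)) \<and>
     (\<forall>\<theta>\<in>natural_params \<xi>. b differentiable at \<theta> \<and> deriv b differentiable at \<theta>) \<and>
     strictly_convex_on (natural_params \<xi>) b"

definition mean :: "real measure \<Rightarrow> real" where
  "mean \<nu> = (\<integral>x. x \<partial>\<nu>)"

definition mean_range :: "real measure \<Rightarrow> (real \<Rightarrow> real) \<Rightarrow> real set" where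
  "mean_range \<xi> b = mean ` exp_family \<xi> b"

(* For a canonical family the mean range is an open interval; these are its endpoints,
   which may be infinite. *)
definition mean_lower :: "real measure \<Rightarrow> (real \<Rightarrow> real) \<Rightarrow> ereal" where
  "mean_lower \<xi> b = (INF m\<in>mean_range \<xi> b. ereal m)"

definition mean_upper :: "real measure \<Rightarrow> (real \<Rightarrow> real) \<Rightarrow> ereal" where
  "mean_upper \<xi> b = (SUP m\<in>mean_range \<xi> b. ereal m)"

definition param_of_mean :: "real measure \<Rightarrow> (real \<Rightarrow> real) \<Rightarrow> real \<Rightarrow> real" where
  "param_of_mean \<xi> b = the_inv_into (natural_params \<xi>) (deriv b)"

(* KL_divergence takes the base of the logarithm first and the reference measure second:
   KL_divergence (exp 1) Q P is KL(P, Q) in nats. *)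
definition mean_div :: "real measure \<Rightarrow> (real \<Rightarrow> real) \<Rightarrow> real \<Rightarrow> real \<Rightarrow> real" where
  "mean_div \<xi> b \<mu> \<mu>' =
     KL_divergence (exp 1) (exp_dist \<xi> b (param_of_mean \<xi> b \<mu>'))
                           (exp_dist \<xi> b (param_of_mean \<xi> b \<mu>))"

definition sample_space :: "real measure \<Rightarrow> (nat \<Rightarrow> real) measure" where
  "sample_space \<nu> = (\<Pi>\<^sub>M i\<in>UNIV. \<nu>)"

(* L n \<delta> maps the tuple of the first n observations (indexed from 0) to the left endpoint.
   The interval is one of candidate means, so its left endpoint is never below the
   infimum of the mean range. *)
type_synonym policy = "nat \<Rightarrow> real \<Rightarrow> (nat \<Rightarrow> real) \<Rightarrow> ereal"

definition left_end :: "policy \<Rightarrow> nat \<Rightarrow> real \<Rightarrow> (nat \<Rightarrow> real) \<Rightarrow> ereal" where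
  "left_end L n \<delta> \<omega> = L n \<delta> (restrict \<omega> {..<n})"

definition one_sided_policy :: "real measure \<Rightarrow> (real \<Rightarrow> real) \<Rightarrow> policy \<Rightarrow> bool" where
  "one_sided_policy \<xi> b L \<longleftrightarrow>
     (\<forall>n\<ge>1. \<forall>\<delta>. 0 < \<delta> \<and> \<delta> < 1 \<longrightarrow>
        L n \<delta> \<in> borel_measurable (\<Pi>\<^sub>M i\<in>{..<n}. (borel :: real measure)) \<and>
        (\<forall>x \<in> space (\<Pi>\<^sub>M i\<in>{..<n}. (borel :: real measure)). mean_lower \<xi> b \<le> L n \<delta> x))"

definition covers :: "real measure \<Rightarrow> (real \<Rightarrow> real) \<Rightarrow> policy \<Rightarrow> bool" where
  "covers \<xi> b L \<longleftrightarrow>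
     (\<forall>\<nu>\<in>exp_family \<xi> b. \<forall>\<delta>. 0 < \<delta> \<and> \<delta> < 1 \<longrightarrow> (\<forall>n\<ge>1.
        measure (sample_space \<nu>)
          {\<omega> \<in> space (sample_space \<nu>). ereal (mean \<nu>) \<in> {left_end L n \<delta> \<omega> ..< mean_upper \<xi> b}}
        \<ge> 1 - \<delta>))"

(* Neighbourhoods instead of a distance, so that the limit may be infinite; for a real limit
   this is the usual notion. *)
definition converges_in_prob ::
  "'a measure \<Rightarrow> ('i \<Rightarrow> 'a \<Rightarrow> ereal) \<Rightarrow> ereal \<Rightarrow> 'i filter \<Rightarrow> bool" where
  "converges_in_prob M X c F \<longleftrightarrow>
     (\<forall>U. open U \<and> c \<in> U \<longrightarrow> ((\<lambda>i. measure M {\<omega> \<in> space M. X i \<omega> \<notin> U}) \<longlongrightarrow> 0) F)"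

definition stable_limit :: "(real \<Rightarrow> nat) \<Rightarrow> real measure \<Rightarrow> policy \<Rightarrow> ereal \<Rightarrow> bool" where
  "stable_limit N \<nu> L c \<longleftrightarrow>
     c \<le> ereal (mean \<nu>) \<and>
     converges_in_prob (sample_space \<nu>) (\<lambda>\<delta>. left_end L (N \<delta>) \<delta>) c (at_right 0)"

definition stable_CI_policies ::
  "real measure \<Rightarrow> (real \<Rightarrow> real) \<Rightarrow> (real \<Rightarrow> nat) \<Rightarrow> real measure \<Rightarrow> policy set" where
  "stable_CI_policies \<xi> b N \<nu> =
     {L. one_sided_policy \<xi> b L \<and> covers \<xi> b L \<and> (\<exists>c. stable_limit N \<nu> L c)}"

definition solves_left ::
  "real measure \<Rightarrow> (real \<Rightarrow> real) \<Rightarrow> real \<Rightarrow> real \<Rightarrow> real \<Rightarrow> bool" where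
  "solves_left \<xi> b \<mu> k m \<longleftrightarrow> m \<in> mean_range \<xi> b \<and> m < \<mu> \<and> mean_div \<xi> b \<mu> m = 1 / k"

(* The equation has no solution when the divergence stays below 1 / k on the whole left part of
   the mean range. This happens for small k when the natural parameter set has a finite left
   endpoint at which b stays bounded, e.g. for \<xi> with density 1 / x^2 on x < -1.
   The infimum of the mean range is then the natural value. *)
definition mu_L_star ::
  "real measure \<Rightarrow> (real \<Rightarrow> real) \<Rightarrow> real \<Rightarrow> real \<Rightarrow> ereal" where
  "mu_L_star \<xi> b \<mu> k =
     (if \<exists>m. solves_left \<xi> b \<mu> k m then ereal (THE m. solves_left \<xi> b \<mu> k m)
      else mean_lower \<xi> b)"

end

theory Submission
  imports Defs
begin

text \<open>
  A left endpoint above a candidate mean \<open>m\<close> is an error when \<open>m\<close> is the true mean, so coverage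
  allows it probability at most \<open>\<delta>\<close> under the member of the family with mean \<open>m\<close>.  A sample of
  size \<open>n\<close> cannot tell that member from the true distribution too well: the probability \<open>p\<close> of
  this event under the true distribution satisfies \<open>p * ln (1 / \<delta>) \<le> n * d(\<mu>, m) + ln 2\<close>
  (\<open>exceedance_bound\<close>, from the Donsker-Varadhan inequality \<open>change_of_measure_bound\<close>).  No law of
  large numbers enters; linearity of the expected log-likelihood ratio is enough.

  With \<open>n = N \<delta>\<close>, division by \<open>ln (1 / \<delta>)\<close> shows that \<open>p\<close> is asymptotically at most
  \<open>k * d(\<mu>, m)\<close>, where \<open>k\<close> is the limit of \<open>N \<delta> / ln (1 / \<delta>)\<close>.  For \<open>k = 0\<close> the left endpoint
  exceeds each \<open>m\<close> of the mean range with vanishing probability and must tend to the infimum of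
  the range (\<open>no_learning\<close>).  For \<open>k > 0\<close> the left endpoint cannot converge to a limit above an \<open>m\<close> with
  \<open>d(\<mu>, m) < 1 / k\<close>, since then \<open>p\<close> would tend to one (\<open>stable_limit_le\<close>).

  It remains to describe the set of these \<open>m\<close> (\<open>le_mu_L_star\<close>).  The mean of the member with
  parameter \<open>\<theta>\<close> is \<open>b' \<theta>\<close>, which is strictly increasing by strict convexity, and in natural
  parameters \<open>d\<close> is the Bregman divergence of \<open>b\<close>.  It is continuous and strictly decreasing to the
  left of the true parameter, so the means with divergence below \<open>1 / k\<close> fill the interval between
  the unique solution of the equation, or the infimum of the range if there is none, and \<open>\<mu>\<close>.
\<close>

section \<open>Change of measure\<close>

lemma density_PiM:
  fixes f :: "'i \<Rightarrow> 'a \<Rightarrow> ennreal"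
  assumes fin: "finite I"
    and M: "product_sigma_finite M"
    and fM: "product_sigma_finite (\<lambda>i. density (M i) (f i))"
    and f [measurable]: "\<And>i. i \<in> I \<Longrightarrow> f i \<in> borel_measurable (M i)"
  shows "(\<Pi>\<^sub>M i\<in>I. density (M i) (f i)) = density (Pi\<^sub>M I M) (\<lambda>x. \<Prod>i\<in>I. f i (x i))"
proof -
  interpret M: product_sigma_finite M by fact
  interpret fM: product_sigma_finite "\<lambda>i. density (M i) (f i)" by fact
  have meas: "(\<lambda>x. \<Prod>i\<in>I. f i (x i)) \<in> borel_measurable (Pi\<^sub>M I M)"
    by measurable
  have "density (Pi\<^sub>M I M) (\<lambda>x. \<Prod>i\<in>I. f i (x i)) = (\<Pi>\<^sub>M i\<in>I. density (M i) (f i))"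
  proof (rule fM.PiM_eqI[OF fin])
    show "sets (density (Pi\<^sub>M I M) (\<lambda>x. \<Prod>i\<in>I. f i (x i))) = sets (\<Pi>\<^sub>M i\<in>I. density (M i) (f i))"
      by (simp cong: sets_PiM_cong)
  next
    fix A assume "\<And>i. i \<in> I \<Longrightarrow> A i \<in> sets (density (M i) (f i))"
    then have A [measurable]: "\<And>i. i \<in> I \<Longrightarrow> A i \<in> sets (M i)"
      by simp
    have box: "Pi\<^sub>E I A \<in> sets (Pi\<^sub>M I M)"
      using fin A by (intro sets_PiM_I_finite)
    have "emeasure (density (Pi\<^sub>M I M) (\<lambda>x. \<Prod>i\<in>I. f i (x i))) (Pi\<^sub>E I A)
        = (\<integral>\<^sup>+x. (\<Prod>i\<in>I. f i (x i)) * indicator (Pi\<^sub>E I A) x \<partial>Pi\<^sub>M I M)"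
      by (rule emeasure_density[OF meas box])
    also have "\<dots> = (\<integral>\<^sup>+x. (\<Prod>i\<in>I. f i (x i) * indicator (A i) (x i)) \<partial>Pi\<^sub>M I M)"
    proof (rule nn_integral_cong)
      fix x assume x: "x \<in> space (Pi\<^sub>M I M)"
      have "indicator (Pi\<^sub>E I A) x = (\<Prod>i\<in>I. indicator (A i) (x i) :: ennreal)"
        using x fin by (auto simp: indicator_def space_PiM PiE_iff)
      then show "(\<Prod>i\<in>I. f i (x i)) * indicator (Pi\<^sub>E I A) x
          = (\<Prod>i\<in>I. f i (x i) * indicator (A i) (x i))"
        by (simp add: prod.distrib)
    qed
    also have "\<dots> = (\<Prod>i\<in>I. \<integral>\<^sup>+x. f i x * indicator (A i) x \<partial>M i)"
      by (rule M.product_nn_integral_prod[OF fin]) measurable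
    also have "\<dots> = (\<Prod>i\<in>I. emeasure (density (M i) (f i)) (A i))"
      by (intro prod.cong refl) (simp add: emeasure_density)
    finally show "emeasure (density (Pi\<^sub>M I M) (\<lambda>x. \<Prod>i\<in>I. f i (x i))) (Pi\<^sub>E I A)
        = (\<Prod>i\<in>I. emeasure (density (M i) (f i)) (A i))" .
  qed
  then show ?thesis ..
qed

text \<open>
  This is the Donsker-Varadhan inequality for the test function \<open>ln (1 / \<delta>)\<close> times the
  indicator of \<open>A\<close>: with \<open>y = ln (1 / \<delta>) * indicator A - g - ln 2\<close>, integrate \<open>1 + y \<le> exp y\<close>
  under \<open>P\<close>.  Since \<open>exp (- g)\<close> turns \<open>P\<close> into \<open>Q\<close>, the right-hand side integrates to
  \<open>(Q A / \<delta> + Q (- A)) / 2\<close>, which is at most one.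
\<close>
lemma change_of_measure_bound:
  assumes P: "prob_space P" and Q: "prob_space Q"
    and dens: "Q = density P (\<lambda>x. ennreal (exp (- g x)))"
    and g: "integrable P g"
    and A [measurable]: "A \<in> sets P"
    and \<delta>: "0 < \<delta>" and QA: "measure Q A \<le> \<delta>"
  shows "measure P A * ln (1 / \<delta>) \<le> (\<integral>x. g x \<partial>P) + ln 2"
proof -
  interpret P: prob_space P by fact
  interpret Q: prob_space Q by fact
  have [measurable]: "g \<in> borel_measurable P"
    using g by auto
  have sQ [simp]: "sets Q = sets P" "space Q = space P"
    by (simp_all add: dens)
  have AQ: "A \<in> sets Q"
    by simp
  have ind: "integrable P (indicat_real A)" "integrable Q (indicat_real A)"
    using A AQ by (simp_all add: integrable_indicator_iff P.emeasure_eq_measure Q.emeasure_eq_measure)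
  define h where "h x = 1 / 2 + (1 / \<delta> - 1) / 2 * indicator A x" for x
  define y where "y x = ln (1 / \<delta>) * indicator A x - g x - ln 2" for x
  have h: "integrable Q h"
    unfolding h_def using ind by (intro Bochner_Integration.integrable_add
      integrable_mult_right Q.integrable_const)
  have [measurable]: "h \<in> borel_measurable P"
    unfolding h_def by measurable
  have exp_y: "exp (y x) = exp (- g x) *\<^sub>R h x" for x
  proof -
    have "exp (ln (1 / \<delta>) * indicator A x) = 2 * h x"
      using \<delta> by (auto simp: h_def indicator_def field_simps exp_minus)
    moreover have "exp (y x) = exp (ln (1 / \<delta>) * indicator A x) * exp (- g x) / 2"
      by (simp add: y_def exp_diff exp_minus exp_add field_simps)
    ultimately show ?thesis
      by simp
  qed
  have int_y: "integrable P y"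
    unfolding y_def using g ind by (intro Bochner_Integration.integrable_diff
      integrable_mult_right P.integrable_const)
  have "integrable P (\<lambda>x. exp (- g x) *\<^sub>R h x)"
    using h by (simp add: dens integrable_density)
  then have int_e: "integrable P (\<lambda>x. exp (y x))"
    by (simp add: exp_y)
  have "1 + (\<integral>x. y x \<partial>P) = (\<integral>x. 1 + y x \<partial>P)"
    using int_y by (simp add: P.prob_space)
  also have "\<dots> \<le> (\<integral>x. exp (y x) \<partial>P)"
    using int_y int_e by (intro integral_mono) auto
  also have "\<dots> = (\<integral>x. h x \<partial>Q)"
    unfolding dens exp_y by (subst integral_density) auto
  also have "\<dots> = 1 / 2 + (1 / \<delta> - 1) / 2 * measure Q A"
    unfolding h_def using ind(2) Q.prob_space
    by (subst Bochner_Integration.integral_add) simp_all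
  also have "\<dots> \<le> 1"
  proof -
    have "measure Q A / \<delta> \<le> 1"
      using QA \<delta> by simp
    moreover have "(1 / \<delta> - 1) * measure Q A = measure Q A / \<delta> - measure Q A"
      by (simp add: left_diff_distrib)
    ultimately have "(1 / \<delta> - 1) * measure Q A \<le> 1"
      using measure_nonneg[of Q A] by linarith
    moreover have "1 / 2 + x / 2 \<le> 1" if "x \<le> 1" for x :: real
      using that by simp
    ultimately show ?thesis
      by (metis times_divide_eq_left)
  qed
  finally have "(\<integral>x. y x \<partial>P) \<le> 0"
    by simp
  moreover have "(\<integral>x. y x \<partial>P) = ln (1 / \<delta>) * measure P A - (\<integral>x. g x \<partial>P) - ln 2"
    unfolding y_def using g ind(1)
    by (simp add: Bochner_Integration.integral_diff P.prob_space)
  ultimately show ?thesis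
    by (simp add: mult.commute)
qed

text \<open>
  The same bound for the first \<open>n\<close> coordinates of an i.i.d. sequence: the log-likelihood ratio is
  a sum over the sample, so its expectation is multiplied by \<open>n\<close>.
\<close>
lemma iid_change_of_measure_bound:
  assumes P: "prob_space P" and Q: "prob_space Q"
    and dens: "Q = density P (\<lambda>x. ennreal (exp (- g x)))"
    and g: "integrable P g"
    and A: "A \<in> sets (\<Pi>\<^sub>M i\<in>{..<n::nat}. P)"
    and \<delta>: "0 < \<delta>" and QA: "measure (\<Pi>\<^sub>M i\<in>{..<n}. Q) A \<le> \<delta>"
  shows "measure (\<Pi>\<^sub>M i\<in>{..<n}. P) A * ln (1 / \<delta>) \<le> real n * (\<integral>x. g x \<partial>P) + ln 2"
proof -
  interpret P: prob_space P by fact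
  interpret Q: prob_space Q by fact
  let ?Pn = "\<Pi>\<^sub>M i\<in>{..<n}. P" and ?Qn = "\<Pi>\<^sub>M i\<in>{..<n}. Q"
  have [measurable]: "g \<in> borel_measurable P"
    using g by auto
  have Pn: "prob_space ?Pn" and Qn: "prob_space ?Qn"
    by (auto intro!: prob_space_PiM P Q)
  have sf: "product_sigma_finite (\<lambda>i::nat. P)" "product_sigma_finite (\<lambda>i::nat. Q)"
    by (auto simp: product_sigma_finite_def P.sigma_finite_measure_axioms Q.sigma_finite_measure_axioms)
  have "?Qn = density ?Pn (\<lambda>x. \<Prod>i\<in>{..<n}. ennreal (exp (- g (x i))))"
    unfolding dens using sf by (intro density_PiM) (auto simp: dens)
  also have "\<dots> = density ?Pn (\<lambda>x. ennreal (exp (- (\<Sum>i<n. g (x i)))))"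
    by (simp add: prod_ennreal exp_sum sum_negf flip: sum_negf)
  finally have dens_n: "?Qn = density ?Pn (\<lambda>x. ennreal (exp (- (\<Sum>i<n. g (x i)))))" .
  have coord: "integrable ?Pn (\<lambda>x. g (x i))" "(\<integral>x. g (x i) \<partial>?Pn) = (\<integral>x. g x \<partial>P)"
    if "i < n" for i
  proof -
    have d: "distr ?Pn P (\<lambda>\<omega>. \<omega> i) = P"
      using that P by (intro distr_PiM_component) auto
    have m: "(\<lambda>\<omega>. \<omega> i) \<in> measurable ?Pn P"
      using that by (intro measurable_component_singleton) auto
    show "integrable ?Pn (\<lambda>x. g (x i))"
      using integrable_distr_eq[OF m, of g] g by (simp add: d)
    show "(\<integral>x. g (x i) \<partial>?Pn) = (\<integral>x. g x \<partial>P)"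
      using integral_distr[OF m, of g] by (simp add: d)
  qed
  have "measure ?Pn A * ln (1 / \<delta>) \<le> (\<integral>x. (\<Sum>i<n. g (x i)) \<partial>?Pn) + ln 2"
    by (rule change_of_measure_bound[OF Pn Qn dens_n _ A \<delta> QA])
       (auto intro!: Bochner_Integration.integrable_sum coord)
  also have "(\<integral>x. (\<Sum>i<n. g (x i)) \<partial>?Pn) = real n * (\<integral>x. g x \<partial>P)"
    by (subst Bochner_Integration.integral_sum) (auto simp: coord)
  finally show ?thesis .
qed

section \<open>Geometry of the exponential family\<close>

locale canonical_family =
  fixes \<xi> :: "real measure" and b :: "real \<Rightarrow> real"
  assumes canonical: "canonical_exp_family \<xi> b"
begin

abbreviation \<Theta> :: "real set" where "\<Theta> \<equiv> natural_params \<xi>"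
abbreviation P :: "real \<Rightarrow> real measure" where "P \<equiv> exp_dist \<xi> b"

lemma sets_\<xi> [simp, measurable_cong]: "sets \<xi> = sets borel"
  using canonical by (simp add: canonical_exp_family_def)

lemma sets_P [simp, measurable_cong]: "sets (P \<theta>) = sets borel"
  by (simp add: exp_dist_def)

lemma space_P [simp]: "space (P \<theta>) = UNIV"
  using sets_eq_imp_space_eq[OF sets_P] by simp

lemma space_sample_space [simp]: "space (sample_space (P \<theta>)) = UNIV"
  by (simp add: sample_space_def space_PiM PiE_UNIV_domain)

lemma open_\<Theta>: "open \<Theta>"
  and prob_space_P: "\<theta> \<in> \<Theta> \<Longrightarrow> prob_space (P \<theta>)"
  using canonical by (auto simp: canonical_exp_family_def)

lemma prob_space_sample_space: "\<theta> \<in> \<Theta> \<Longrightarrow> prob_space (sample_space (P \<theta>))"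
  unfolding sample_space_def by (intro prob_space_PiM prob_space_P)

lemma measure_P_UNIV: "\<theta> \<in> \<Theta> \<Longrightarrow> measure (P \<theta>) UNIV = 1"
  using prob_space.prob_space[OF prob_space_P] by simp

lemma between_\<Theta>: "u \<in> \<Theta> \<Longrightarrow> v \<in> \<Theta> \<Longrightarrow> u \<le> w \<Longrightarrow> w \<le> v \<Longrightarrow> w \<in> \<Theta>"
  using canonical unfolding canonical_exp_family_def is_interval_1 by blast

lemma DERIV_b: "\<theta> \<in> \<Theta> \<Longrightarrow> DERIV b \<theta> :> deriv b \<theta>"
  using canonical by (auto simp: canonical_exp_family_def DERIV_deriv_iff_real_differentiable)

lemma isCont_deriv_b: "\<theta> \<in> \<Theta> \<Longrightarrow> isCont (deriv b) \<theta>"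
  using canonical by (auto simp: canonical_exp_family_def intro: differentiable_imp_continuous_within)

lemma P_change: "P \<theta>' = density (P \<theta>) (\<lambda>x. ennreal (exp ((\<theta>' - \<theta>) * x - (b \<theta>' - b \<theta>))))"
proof -
  have "exp (\<theta> * x - b \<theta>) * exp ((\<theta>' - \<theta>) * x - (b \<theta>' - b \<theta>)) = exp (\<theta>' * x - b \<theta>')" for x
    by (simp add: algebra_simps flip: exp_add)
  then show ?thesis
    unfolding exp_dist_def by (subst density_density_eq) (simp_all flip: ennreal_mult')
qed

lemma integrable_id_P:
  assumes "\<theta> \<in> \<Theta>"
  shows "integrable (P \<theta>) (\<lambda>x. x)"
proof -
  have "integrable \<xi> (\<lambda>x. exp (- b \<theta>) * (\<bar>x\<bar> * exp (\<theta> * x)))"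
    using assms by (intro integrable_mult_right) (simp add: natural_params_def)
  then have "integrable \<xi> (\<lambda>x. exp (\<theta> * x - b \<theta>) *\<^sub>R x)"
    by (rule Bochner_Integration.integrable_bound)
       (auto simp: abs_mult exp_diff exp_minus field_simps)
  then show ?thesis
    unfolding exp_dist_def by (subst integrable_density) auto
qed

text \<open>
  Integrating \<open>1 + y \<le> exp y\<close> for the log-likelihood ratio \<open>y\<close> of \<open>P \<theta>'\<close> against \<open>P \<theta>\<close>
  exhibits the mean as a subgradient of \<open>b\<close>.  Being differentiable, \<open>b\<close> has only one
  subgradient, which gives \<open>mean (P \<theta>) = b' \<theta>\<close> without differentiating under the integral sign.
\<close>
lemma mean_subgradient:
  assumes \<theta>: "\<theta> \<in> \<Theta>" and \<theta>': "\<theta>' \<in> \<Theta>"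
  shows "b \<theta> + mean (P \<theta>) * (\<theta>' - \<theta>) \<le> b \<theta>'"
proof -
  interpret P: prob_space "P \<theta>" using \<theta> by (rule prob_space_P)
  interpret P': prob_space "P \<theta>'" using \<theta>' by (rule prob_space_P)
  let ?y = "\<lambda>x. (\<theta>' - \<theta>) * x - (b \<theta>' - b \<theta>)"
  have int_y: "integrable (P \<theta>) ?y"
    using integrable_id_P[OF \<theta>] by auto
  have "integrable (P \<theta>') (\<lambda>x. 1::real)"
    by simp
  then have int_e: "integrable (P \<theta>) (\<lambda>x. exp (?y x))"
    by (simp add: P_change[of \<theta>' \<theta>] integrable_density)
  have "1 + (mean (P \<theta>) * (\<theta>' - \<theta>) - (b \<theta>' - b \<theta>)) = (\<integral>x. 1 + ?y x \<partial>P \<theta>)"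
    using integrable_id_P[OF \<theta>] int_y by (simp add: measure_P_UNIV[OF \<theta>] mean_def)
  also have "\<dots> \<le> (\<integral>x. exp (?y x) \<partial>P \<theta>)"
    using int_y int_e by (intro integral_mono) auto
  also have "\<dots> = (\<integral>x. 1 \<partial>P \<theta>')"
    unfolding P_change[of \<theta>' \<theta>] by (subst integral_density) auto
  also have "\<dots> = 1"
    by (simp add: measure_P_UNIV[OF \<theta>'])
  finally show ?thesis
    by simp
qed

lemma mean_P:
  assumes \<theta>: "\<theta> \<in> \<Theta>"
  shows "mean (P \<theta>) = deriv b \<theta>"
proof -
  obtain e where e: "e > 0" "ball \<theta> e \<subseteq> \<Theta>"
    using open_\<Theta> \<theta> by (auto simp: open_contains_ball)
  have "DERIV (\<lambda>u. b u - mean (P \<theta>) * u) \<theta> :> deriv b \<theta> - mean (P \<theta>)"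
    using DERIV_b[OF \<theta>] by (auto intro!: derivative_eq_intros)
  moreover have "b \<theta> - mean (P \<theta>) * \<theta> \<le> b u - mean (P \<theta>) * u" if "\<bar>\<theta> - u\<bar> < e" for u
    using mean_subgradient[OF \<theta>, of u] that e by (auto simp: dist_real_def algebra_simps subset_eq)
  ultimately have "deriv b \<theta> - mean (P \<theta>) = 0"
    using e by (intro DERIV_local_min) auto
  then show ?thesis
    by simp
qed

lemma subgradient: "\<theta> \<in> \<Theta> \<Longrightarrow> \<theta>' \<in> \<Theta> \<Longrightarrow> b \<theta> + deriv b \<theta> * (\<theta>' - \<theta>) \<le> b \<theta>'"
  using mean_subgradient[of \<theta> \<theta>'] by (simp add: mean_P)

text \<open>
  Strict convexity puts \<open>b\<close> at the midpoint strictly below the chord, while both tangents at the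
  ends lie below \<open>b\<close> there; this forces the slopes to be strictly ordered.
\<close>
lemma deriv_b_strict_mono:
  assumes u: "u \<in> \<Theta>" and v: "v \<in> \<Theta>" and uv: "u < v"
  shows "deriv b u < deriv b v"
proof -
  let ?w = "(u + v) / 2"
  have w: "?w \<in> \<Theta>"
    using between_\<Theta>[OF u v, of ?w] uv by simp
  have strict_convex: "\<forall>x\<in>\<Theta>. \<forall>y\<in>\<Theta>. \<forall>t. x \<noteq> y \<and> 0 < t \<and> t < 1 \<longrightarrow>
      b ((1 - t) * x + t * y) < (1 - t) * b x + t * b y"
    using canonical by (simp add: canonical_exp_family_def strictly_convex_on_def)
  have "b ((1 - 1/2) * u + (1/2) * v) < (1 - 1/2) * b u + (1/2) * b v"
    using strict_convex[rule_format, OF u v, of "1/2"] uv by simp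
  also have "(1 - 1/2) * u + (1/2) * v = ?w"
    by (simp add: field_simps)
  finally have "b ?w < (1 - 1/2) * b u + (1/2) * b v" .
  then have "2 * b ?w < b u + b v"
    by simp
  moreover have "b u + deriv b u * ((v - u) / 2) \<le> b ?w" "b v - deriv b v * ((v - u) / 2) \<le> b ?w"
    using subgradient[OF u w] subgradient[OF v w] by (simp_all add: field_simps)
  ultimately have "0 < (deriv b v - deriv b u) * ((v - u) / 2)"
    unfolding left_diff_distrib by linarith
  then show ?thesis
    using uv by (simp add: zero_less_mult_iff)
qed

lemma deriv_b_less_iff: "u \<in> \<Theta> \<Longrightarrow> v \<in> \<Theta> \<Longrightarrow> deriv b u < deriv b v \<longleftrightarrow> u < v"
  using deriv_b_strict_mono[of u v] deriv_b_strict_mono[of v u]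
  by (cases u v rule: linorder_cases) auto

lemma inj_deriv_b: "inj_on (deriv b) \<Theta>"
  by (rule strict_mono_on_imp_inj_on) (simp add: strict_mono_on_def deriv_b_strict_mono)

lemma param_of_mean: "\<theta> \<in> \<Theta> \<Longrightarrow> param_of_mean \<xi> b (deriv b \<theta>) = \<theta>"
  unfolding param_of_mean_def by (rule the_inv_into_f_f[OF inj_deriv_b])

lemma mean_range: "mean_range \<xi> b = deriv b ` \<Theta>"
  by (auto simp: mean_range_def exp_family_def image_image mean_P)

definition bregman :: "real \<Rightarrow> real \<Rightarrow> real" where
  "bregman \<theta> \<theta>' = b \<theta>' - b \<theta> - deriv b \<theta> * (\<theta>' - \<theta>)"

lemma integral_log_ratio:
  assumes \<theta>: "\<theta> \<in> \<Theta>"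
  shows "integrable (P \<theta>) (\<lambda>x. (\<theta> - \<theta>') * x - (b \<theta> - b \<theta>'))"
    and "(\<integral>x. (\<theta> - \<theta>') * x - (b \<theta> - b \<theta>') \<partial>P \<theta>) = bregman \<theta> \<theta>'"
proof -
  interpret P: prob_space "P \<theta>" using \<theta> by (rule prob_space_P)
  show "integrable (P \<theta>) (\<lambda>x. (\<theta> - \<theta>') * x - (b \<theta> - b \<theta>'))"
    using integrable_id_P[OF \<theta>] by auto
  show "(\<integral>x. (\<theta> - \<theta>') * x - (b \<theta> - b \<theta>') \<partial>P \<theta>) = bregman \<theta> \<theta>'"
    using integrable_id_P[OF \<theta>] mean_P[OF \<theta>]
    by (simp add: measure_P_UNIV[OF \<theta>] mean_def bregman_def algebra_simps)
qed

text \<open>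
  The log-likelihood ratio of two members is affine in the observation, so its expectation only
  depends on the mean.
\<close>
lemma mean_div_eq_bregman:
  assumes \<theta>: "\<theta> \<in> \<Theta>" and \<theta>': "\<theta>' \<in> \<Theta>"
  shows "mean_div \<xi> b (deriv b \<theta>) (deriv b \<theta>') = bregman \<theta> \<theta>'"
proof -
  interpret P': prob_space "P \<theta>'" using \<theta>' by (rule prob_space_P)
  let ?y = "\<lambda>x. (\<theta> - \<theta>') * x - (b \<theta> - b \<theta>')"
  have "mean_div \<xi> b (deriv b \<theta>) (deriv b \<theta>') = KL_divergence (exp 1) (P \<theta>') (P \<theta>)"
    using \<theta> \<theta>' by (simp add: mean_div_def param_of_mean)
  also have "\<dots> = (\<integral>x. exp (?y x) * log (exp 1) (exp (?y x)) \<partial>P \<theta>')"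
    unfolding P_change[of \<theta> \<theta>'] by (rule P'.KL_density) auto
  also have "\<dots> = (\<integral>x. ?y x \<partial>P \<theta>)"
    unfolding P_change[of \<theta> \<theta>'] by (subst integral_density) (auto simp: log_def)
  finally show ?thesis
    using integral_log_ratio(2)[OF \<theta>] by simp
qed

lemma bregman_strict_antimono:
  assumes u: "u \<in> \<Theta>" and v: "v \<in> \<Theta>" and \<theta>: "\<theta> \<in> \<Theta>" and "u < v" "v < \<theta>"
  shows "bregman \<theta> v < bregman \<theta> u"
proof -
  have "0 < (deriv b \<theta> - deriv b v) * (v - u)"
    using deriv_b_strict_mono[OF v \<theta>] assms by simp
  also have "\<dots> \<le> bregman \<theta> u - bregman \<theta> v"
    using subgradient[OF v u] by (simp add: bregman_def algebra_simps)
  finally show ?thesis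
    by simp
qed

text \<open>By the intermediate value theorem, as the divergence is continuous and vanishes at \<open>\<theta>\<close>.\<close>
lemma bregman_attains:
  assumes u: "u \<in> \<Theta>" and \<theta>: "\<theta> \<in> \<Theta>" and "u < \<theta>" and c: "0 < c" "c \<le> bregman \<theta> u"
  obtains v where "v \<in> \<Theta>" "v < \<theta>" "bregman \<theta> v = c"
proof -
  have "isCont (bregman \<theta>) x" if "u \<le> x" "x \<le> \<theta>" for x
    using DERIV_isCont[OF DERIV_b[OF between_\<Theta>[OF u \<theta> that]]]
    unfolding bregman_def by (intro continuous_intros)
  moreover have "bregman \<theta> \<theta> \<le> c"
    using c by (simp add: bregman_def)
  ultimately obtain v where v: "u \<le> v" "v \<le> \<theta>" "bregman \<theta> v = c"
    using IVT2[of "bregman \<theta>" \<theta> c u] c \<open>u < \<theta>\<close> by auto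
  then have "v \<noteq> \<theta>"
    using c by (auto simp: bregman_def)
  then show thesis
    using v between_\<Theta>[OF u \<theta>] by (intro that[of v]) auto
qed

lemma solves_left_iff:
  assumes \<theta>: "\<theta> \<in> \<Theta>"
  shows "solves_left \<xi> b (deriv b \<theta>) k m \<longleftrightarrow> (\<exists>u\<in>\<Theta>. m = deriv b u \<and> u < \<theta> \<and> bregman \<theta> u = 1 / k)"
proof -
  have "solves_left \<xi> b (deriv b \<theta>) k m \<longleftrightarrow>
      (\<exists>u\<in>\<Theta>. m = deriv b u \<and> deriv b u < deriv b \<theta> \<and> mean_div \<xi> b (deriv b \<theta>) (deriv b u) = 1 / k)"
    unfolding solves_left_def mean_range by blast
  also have "\<dots> \<longleftrightarrow> (\<exists>u\<in>\<Theta>. m = deriv b u \<and> u < \<theta> \<and> bregman \<theta> u = 1 / k)"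
    by (rule bex_cong[OF refl]) (simp only: deriv_b_less_iff[OF _ \<theta>] mean_div_eq_bregman[OF \<theta>])
  finally show ?thesis .
qed

lemma solves_left_unique:
  assumes \<theta>: "\<theta> \<in> \<Theta>"
    and "solves_left \<xi> b (deriv b \<theta>) k m" "solves_left \<xi> b (deriv b \<theta>) k m'"
  shows "m = m'"
proof -
  obtain u v where u: "u \<in> \<Theta>" "m = deriv b u" "u < \<theta>" "bregman \<theta> u = 1 / k"
    and v: "v \<in> \<Theta>" "m' = deriv b v" "v < \<theta>" "bregman \<theta> v = 1 / k"
    using assms(2,3) unfolding solves_left_iff[OF \<theta>] by blast
  have "u = v"
    using bregman_strict_antimono[OF u(1) v(1) \<theta>] bregman_strict_antimono[OF v(1) u(1) \<theta>] u v
    by (cases u v rule: linorder_cases) auto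
  then show ?thesis
    using u v by simp
qed

section \<open>Exceedance probabilities of a one-sided policy\<close>

abbreviation exceedance :: "policy \<Rightarrow> nat \<Rightarrow> real \<Rightarrow> real \<Rightarrow> (nat \<Rightarrow> real) set" where
  "exceedance L n \<delta> m \<equiv> {\<omega>. ereal m < left_end L n \<delta> \<omega>}"

text \<open>
  Distinct members of the family have mutually singular infinite products, so likelihood ratios are
  available only for finite samples.  The event that the left endpoint exceeds \<open>m\<close> depends on the
  first \<open>n\<close> observations only and can be moved there, as one set \<open>A\<close> for all members.
\<close>
lemma exceedance_finite_sample:
  assumes policy: "one_sided_policy \<xi> b L" and n: "n \<ge> 1" and \<delta>: "0 < \<delta>" "\<delta> < 1"
  obtains A where "\<And>\<theta>. A \<in> sets (\<Pi>\<^sub>M i\<in>{..<n}. P \<theta>)"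
    and "\<And>\<theta>. \<theta> \<in> \<Theta> \<Longrightarrow> exceedance L n \<delta> m \<in> sets (sample_space (P \<theta>))"
    and "\<And>\<theta>. \<theta> \<in> \<Theta> \<Longrightarrow>
      measure (sample_space (P \<theta>)) (exceedance L n \<delta> m) = measure (\<Pi>\<^sub>M i\<in>{..<n}. P \<theta>) A"
proof
  let ?F = "\<Pi>\<^sub>M i\<in>{..<n}. (borel :: real measure)"
  let ?A = "{x \<in> space ?F. ereal m < L n \<delta> x}"
  have [measurable]: "L n \<delta> \<in> borel_measurable ?F"
    using policy n \<delta> by (auto simp: one_sided_policy_def)
  have "?A \<in> sets ?F"
    by measurable
  moreover have "sets (\<Pi>\<^sub>M i\<in>{..<n}. P \<theta>) = sets ?F" for \<theta>
    by (intro sets_PiM_cong) auto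
  ultimately show A: "?A \<in> sets (\<Pi>\<^sub>M i\<in>{..<n}. P \<theta>)" for \<theta>
    by simp
  fix \<theta> assume \<theta>: "\<theta> \<in> \<Theta>"
  interpret product_prob_space "\<lambda>i::nat. P \<theta>" UNIV
    using prob_space_P[OF \<theta>]
    by (simp add: product_prob_space_def product_prob_space_axioms_def product_sigma_finite_def
        prob_space_imp_sigma_finite)
  have restr: "(\<lambda>\<omega>. restrict \<omega> {..<n}) \<in> measurable (sample_space (P \<theta>)) (\<Pi>\<^sub>M i\<in>{..<n}. P \<theta>)"
    unfolding sample_space_def by (rule measurable_restrict_subset) simp
  have vimage: "(\<lambda>\<omega>. restrict \<omega> {..<n}) -` ?A \<inter> space (sample_space (P \<theta>)) = exceedance L n \<delta> m"
    by (auto simp: left_end_def space_PiM)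
  have "distr (sample_space (P \<theta>)) (\<Pi>\<^sub>M i\<in>{..<n}. P \<theta>) (\<lambda>\<omega>. restrict \<omega> {..<n}) = (\<Pi>\<^sub>M i\<in>{..<n}. P \<theta>)"
    unfolding sample_space_def by (rule distr_PiM_restrict_finite) auto
  then show "measure (sample_space (P \<theta>)) (exceedance L n \<delta> m) = measure (\<Pi>\<^sub>M i\<in>{..<n}. P \<theta>) ?A"
    using measure_distr[OF restr A] unfolding vimage by simp
  show "exceedance L n \<delta> m \<in> sets (sample_space (P \<theta>))"
    using measurable_sets[OF restr A] unfolding vimage .
qed

text \<open>
  Under \<open>P \<theta>'\<close> a left endpoint above the mean means that the interval misses the mean, which has
  probability at most \<open>\<delta>\<close>.  The change of measure transfers this to \<open>P \<theta>\<close>.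
\<close>
lemma exceedance_bound:
  assumes \<theta>: "\<theta> \<in> \<Theta>" and \<theta>': "\<theta>' \<in> \<Theta>"
    and policy: "one_sided_policy \<xi> b L" and cov: "covers \<xi> b L"
    and n: "n \<ge> 1" and \<delta>: "0 < \<delta>" "\<delta> < 1"
  shows "measure (sample_space (P \<theta>)) (exceedance L n \<delta> (deriv b \<theta>')) * ln (1 / \<delta>)
    \<le> real n * bregman \<theta> \<theta>' + ln 2"
proof -
  let ?E = "exceedance L n \<delta> (deriv b \<theta>')"
  obtain A where A: "\<And>\<theta>. A \<in> sets (\<Pi>\<^sub>M i\<in>{..<n}. P \<theta>)"
    and E: "\<And>\<theta>. \<theta> \<in> \<Theta> \<Longrightarrow> ?E \<in> sets (sample_space (P \<theta>))"
    and EA: "\<And>\<theta>. \<theta> \<in> \<Theta> \<Longrightarrow> measure (sample_space (P \<theta>)) ?E = measure (\<Pi>\<^sub>M i\<in>{..<n}. P \<theta>) A"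
    using exceedance_finite_sample[OF policy n \<delta>] by blast
  have miss: "measure (\<Pi>\<^sub>M i\<in>{..<n}. P \<theta>') A \<le> \<delta>"
  proof -
    let ?S = "sample_space (P \<theta>')"
    interpret S: prob_space ?S
      using \<theta>' by (rule prob_space_sample_space)
    have "P \<theta>' \<in> exp_family \<xi> b"
      using \<theta>' by (simp add: exp_family_def)
    then have "1 - \<delta> \<le> measure ?S {\<omega> \<in> space ?S. ereal (mean (P \<theta>')) \<in> {left_end L n \<delta> \<omega> ..< mean_upper \<xi> b}}"
      using cov n \<delta> unfolding covers_def by blast
    also have "\<dots> \<le> measure ?S (space ?S - ?E)"
      using E[OF \<theta>'] by (intro S.finite_measure_mono sets.compl_sets) (auto simp: mean_P[OF \<theta>'])
    also have "\<dots> = 1 - measure ?S ?E"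
      using E[OF \<theta>'] by (rule S.prob_compl)
    finally show ?thesis
      using EA[OF \<theta>'] by simp
  qed
  have ratio: "P \<theta>' = density (P \<theta>) (\<lambda>x. ennreal (exp (- ((\<theta> - \<theta>') * x - (b \<theta> - b \<theta>')))))"
    using P_change[of \<theta>' \<theta>] by (simp add: algebra_simps)
  show ?thesis
    using iid_change_of_measure_bound[OF prob_space_P[OF \<theta>] prob_space_P[OF \<theta>'] ratio
        integral_log_ratio(1)[OF \<theta>] A \<delta>(1) miss]
    unfolding EA[OF \<theta>] integral_log_ratio(2)[OF \<theta>] .
qed

text \<open>Dividing by \<open>ln (1 / \<delta>)\<close> leaves a bound that converges when the learning rate does.\<close>
lemma exceedance_asymptotic_bound:
  assumes \<theta>: "\<theta> \<in> \<Theta>" and \<theta>': "\<theta>' \<in> \<Theta>"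
    and policy: "one_sided_policy \<xi> b L" and cov: "covers \<xi> b L"
    and admissible: "\<forall>\<^sub>F \<delta> in at_right 0. N \<delta> \<ge> 1 \<and> 0 < \<delta> \<and> \<delta> < 1"
    and k: "((\<lambda>\<delta>. real (N \<delta>) / ln (1 / \<delta>)) \<longlongrightarrow> k) (at_right 0)"
  obtains r where "(r \<longlongrightarrow> k * bregman \<theta> \<theta>') (at_right 0)"
    and "\<forall>\<^sub>F \<delta> in at_right 0.
      measure (sample_space (P \<theta>)) (exceedance L (N \<delta>) \<delta> (deriv b \<theta>')) \<le> r \<delta>"
proof
  let ?r = "\<lambda>\<delta>. real (N \<delta>) / ln (1 / \<delta>) * bregman \<theta> \<theta>' + ln 2 / ln (1 / \<delta>)"
  have "filterlim (\<lambda>\<delta>::real. ln (1 / \<delta>)) at_top (at_right 0)"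
    using filterlim_compose[OF ln_at_top filterlim_inverse_at_top_right] by (simp add: inverse_eq_divide)
  then have "((\<lambda>\<delta>::real. ln 2 / ln (1 / \<delta>)) \<longlongrightarrow> 0) (at_right 0)"
    by (intro tendsto_divide_0[OF tendsto_const] filterlim_at_top_imp_at_infinity)
  then have "(?r \<longlongrightarrow> k * bregman \<theta> \<theta>' + 0) (at_right 0)"
    by (intro tendsto_intros k)
  then show "(?r \<longlongrightarrow> k * bregman \<theta> \<theta>') (at_right 0)"
    by simp
  show "\<forall>\<^sub>F \<delta> in at_right 0.
      measure (sample_space (P \<theta>)) (exceedance L (N \<delta>) \<delta> (deriv b \<theta>')) \<le> ?r \<delta>"
    using admissible
  proof eventually_elim
    case (elim \<delta>)
    then have ln_pos: "0 < ln (1 / \<delta>)"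
      by simp
    have "measure (sample_space (P \<theta>)) (exceedance L (N \<delta>) \<delta> (deriv b \<theta>'))
        \<le> (real (N \<delta>) * bregman \<theta> \<theta>' + ln 2) / ln (1 / \<delta>)"
      unfolding pos_le_divide_eq[OF ln_pos] using elim by (intro exceedance_bound assms) auto
    then show ?case
      by (simp only: add_divide_distrib times_divide_eq_left)
  qed
qed

text \<open>
  Were \<open>c\<close> above the mean of \<open>P \<theta>'\<close>, the exceedance probability would tend to one, against the
  asymptotic bound \<open>k * bregman \<theta> \<theta>' < 1\<close>.
\<close>
lemma stable_limit_le:
  assumes \<theta>: "\<theta> \<in> \<Theta>" and \<theta>': "\<theta>' \<in> \<Theta>"
    and policy: "one_sided_policy \<xi> b L" and cov: "covers \<xi> b L"
    and admissible: "\<forall>\<^sub>F \<delta> in at_right 0. N \<delta> \<ge> 1 \<and> 0 < \<delta> \<and> \<delta> < 1"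
    and k: "((\<lambda>\<delta>. real (N \<delta>) / ln (1 / \<delta>)) \<longlongrightarrow> k) (at_right 0)"
    and c: "converges_in_prob (sample_space (P \<theta>)) (\<lambda>\<delta>. left_end L (N \<delta>) \<delta>) c (at_right 0)"
    and small: "k * bregman \<theta> \<theta>' < 1"
  shows "c \<le> ereal (deriv b \<theta>')"
proof (rule ccontr)
  assume above: "\<not> c \<le> ereal (deriv b \<theta>')"
  let ?S = "sample_space (P \<theta>)"
  let ?E = "\<lambda>\<delta>. exceedance L (N \<delta>) \<delta> (deriv b \<theta>')"
  let ?D = "\<lambda>\<delta>. {\<omega> \<in> space ?S. left_end L (N \<delta>) \<delta> \<omega> \<notin> {ereal (deriv b \<theta>')<..}}"
  interpret S: prob_space ?S
    using \<theta> by (rule prob_space_sample_space)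
  have D: "((\<lambda>\<delta>. measure ?S (?D \<delta>)) \<longlongrightarrow> 0) (at_right 0)"
    using c above open_greaterThan[of "ereal (deriv b \<theta>')"]
    unfolding converges_in_prob_def not_le by blast
  obtain r where r: "(r \<longlongrightarrow> k * bregman \<theta> \<theta>') (at_right 0)"
    and Er: "\<forall>\<^sub>F \<delta> in at_right 0. measure ?S (?E \<delta>) \<le> r \<delta>"
    using exceedance_asymptotic_bound[OF \<theta> \<theta>' policy cov admissible k] .
  have "\<forall>\<^sub>F \<delta> in at_right 0. 1 \<le> measure ?S (?D \<delta>) + r \<delta>"
    using admissible Er
  proof eventually_elim
    case (elim \<delta>)
    then have "?E \<delta> \<in> sets ?S"
      using exceedance_finite_sample[OF policy, of "N \<delta>" \<delta> "deriv b \<theta>'"] \<theta> by metis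
    moreover have "?D \<delta> = space ?S - ?E \<delta>"
      by auto
    ultimately show ?case
      using S.prob_compl[of "?E \<delta>"] elim by simp
  qed
  then have "1 \<le> 0 + k * bregman \<theta> \<theta>'"
    by (intro tendsto_lowerbound[OF tendsto_add[OF D r]]) auto
  with small show False
    by simp
qed

section \<open>The two regimes\<close>

text \<open>
  Without learning every exceedance probability vanishes, so the left endpoint, which is never
  below the infimum of the mean range, is pressed against it.
\<close>
lemma no_learning:
  assumes \<theta>: "\<theta> \<in> \<Theta>"
    and policy: "one_sided_policy \<xi> b L" and cov: "covers \<xi> b L"
    and admissible: "\<forall>\<^sub>F \<delta> in at_right 0. N \<delta> \<ge> 1 \<and> 0 < \<delta> \<and> \<delta> < 1"
    and k: "((\<lambda>\<delta>. real (N \<delta>) / ln (1 / \<delta>)) \<longlongrightarrow> 0) (at_right 0)"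
  shows "converges_in_prob (sample_space (P \<theta>)) (\<lambda>\<delta> \<omega>. ereal \<mu> - left_end L (N \<delta>) \<delta> \<omega>)
    (ereal \<mu> - mean_lower \<xi> b) (at_right 0)"
  unfolding converges_in_prob_def
proof (intro allI impI)
  fix U :: "ereal set" assume U: "open U \<and> ereal \<mu> - mean_lower \<xi> b \<in> U"
  let ?S = "sample_space (P \<theta>)"
  interpret S: prob_space ?S
    using \<theta> by (rule prob_space_sample_space)
  have "mean_lower \<xi> b \<le> ereal (deriv b \<theta>)"
    unfolding mean_lower_def mean_range using \<theta> by (intro INF_lower2[of "deriv b \<theta>"]) auto
  then have "mean_lower \<xi> b < \<infinity>"
    by auto
  \<comment> \<open>An open set around the infimum of the range contains all extended reals between the infimum and
     some \<open>z\<close> above it; some mean \<open>m\<close> lies below \<open>z\<close>, so leaving \<open>U\<close> forces the left endpoint above \<open>m\<close>.\<close>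
  have "continuous_on UNIV (\<lambda>x. ereal \<mu> - x)"
    unfolding minus_ereal_def continuous_on_def by (auto intro!: tendsto_intros)
  then have V: "open ((\<lambda>x. ereal \<mu> - x) -` U)"
    using U by (auto simp: continuous_on_open_vimage)
  obtain z where z: "mean_lower \<xi> b < z" "{mean_lower \<xi> b..<z} \<subseteq> (\<lambda>x. ereal \<mu> - x) -` U"
    using open_right[OF V, of "mean_lower \<xi> b" \<infinity>] U \<open>mean_lower \<xi> b < \<infinity>\<close> by auto
  then obtain \<theta>' where \<theta>': "\<theta>' \<in> \<Theta>" "ereal (deriv b \<theta>') < z"
    unfolding mean_lower_def mean_range by (auto simp: INF_less_iff)
  obtain r where r: "(r \<longlongrightarrow> 0 * bregman \<theta> \<theta>') (at_right 0)"
    and Er: "\<forall>\<^sub>F \<delta> in at_right 0. measure ?S (exceedance L (N \<delta>) \<delta> (deriv b \<theta>')) \<le> r \<delta>"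
    using exceedance_asymptotic_bound[OF \<theta> \<theta>'(1) policy cov admissible k] .
  show "((\<lambda>\<delta>. measure ?S {\<omega> \<in> space ?S. ereal \<mu> - left_end L (N \<delta>) \<delta> \<omega> \<notin> U}) \<longlongrightarrow> 0) (at_right 0)"
  proof (rule tendsto_sandwich[of "\<lambda>_. 0" _ _ r])
    show "\<forall>\<^sub>F \<delta> in at_right 0. measure ?S {\<omega> \<in> space ?S. ereal \<mu> - left_end L (N \<delta>) \<delta> \<omega> \<notin> U} \<le> r \<delta>"
      using admissible Er
    proof eventually_elim
      case (elim \<delta>)
      have lower: "mean_lower \<xi> b \<le> left_end L (N \<delta>) \<delta> \<omega>" for \<omega>
      proof -
        have "restrict \<omega> {..<N \<delta>} \<in> space (\<Pi>\<^sub>M i\<in>{..<N \<delta>}. (borel :: real measure))"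
          by (simp add: space_PiM)
        then show ?thesis
          using policy elim unfolding one_sided_policy_def left_end_def by blast
      qed
      have "exceedance L (N \<delta>) \<delta> (deriv b \<theta>') \<in> sets ?S"
        using exceedance_finite_sample[OF policy, of "N \<delta>" \<delta> "deriv b \<theta>'"] \<theta> elim by metis
      moreover have "left_end L (N \<delta>) \<delta> \<omega> \<notin> {mean_lower \<xi> b..<z}"
        if "ereal \<mu> - left_end L (N \<delta>) \<delta> \<omega> \<notin> U" for \<omega>
        using that z(2) by auto
      then have "ereal (deriv b \<theta>') < left_end L (N \<delta>) \<delta> \<omega>"
        if "ereal \<mu> - left_end L (N \<delta>) \<delta> \<omega> \<notin> U" for \<omega>
        using that lower[of \<omega>] \<theta>'(2) by fastforce
      ultimately have "measure ?S {\<omega> \<in> space ?S. ereal \<mu> - left_end L (N \<delta>) \<delta> \<omega> \<notin> U}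
          \<le> measure ?S (exceedance L (N \<delta>) \<delta> (deriv b \<theta>'))"
        by (intro S.finite_measure_mono) auto
      with elim show ?case
        by simp
    qed
  qed (use r in auto)
qed

text \<open>
  If the equation has a solution, the parameters below \<open>\<theta>\<close> with divergence below \<open>1 / k\<close> accumulate
  at it from the right, and \<open>b'\<close> is continuous.  Otherwise they are all the parameters below \<open>\<theta>\<close>,
  whose means have the same infimum as the whole mean range.
\<close>
lemma le_mu_L_star:
  assumes \<theta>: "\<theta> \<in> \<Theta>" and k: "k > 0"
    and c: "\<And>\<theta>'. \<theta>' \<in> \<Theta> \<Longrightarrow> \<theta>' < \<theta> \<Longrightarrow> bregman \<theta> \<theta>' < 1 / k \<Longrightarrow> c \<le> ereal (deriv b \<theta>')"
  shows "c \<le> mu_L_star \<xi> b (deriv b \<theta>) k"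
proof (cases "\<exists>m. solves_left \<xi> b (deriv b \<theta>) k m")
  case True
  then obtain v where v: "v \<in> \<Theta>" "v < \<theta>" "bregman \<theta> v = 1 / k"
    and sol: "solves_left \<xi> b (deriv b \<theta>) k (deriv b v)"
    unfolding solves_left_iff[OF \<theta>] by auto
  have "mu_L_star \<xi> b (deriv b \<theta>) k = ereal (deriv b v)"
    using True the_equality[of "solves_left \<xi> b (deriv b \<theta>) k", OF sol solves_left_unique[OF \<theta> _ sol]]
    by (simp add: mu_L_star_def)
  moreover have "c \<le> ereal (deriv b v)"
  proof (rule tendsto_lowerbound)
    show "((\<lambda>w. ereal (deriv b w)) \<longlongrightarrow> ereal (deriv b v)) (at_right v)"
      using isCont_deriv_b[OF v(1)] by (intro tendsto_ereal) (simp add: isCont_def filterlim_at_split)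
    have "c \<le> ereal (deriv b w)" if "v < w" "w < \<theta>" for w
    proof -
      have w: "w \<in> \<Theta>"
        using between_\<Theta>[OF v(1) \<theta>, of w] that by simp
      show ?thesis
        using bregman_strict_antimono[OF v(1) w \<theta> that] v(3) by (intro c[OF w that(2)]) simp
    qed
    then show "\<forall>\<^sub>F w in at_right v. c \<le> ereal (deriv b w)"
      using v(2) by (auto simp: eventually_at_right_field)
  qed simp
  ultimately show ?thesis
    by simp
next
  case False
  have below: "c \<le> ereal (deriv b u)" if u: "u \<in> \<Theta>" "u < \<theta>" for u
  proof (rule c[OF u], rule ccontr)
    assume "\<not> bregman \<theta> u < 1 / k"
    then obtain v where "v \<in> \<Theta>" "v < \<theta>" "bregman \<theta> v = 1 / k"
      using bregman_attains[OF u(1) \<theta> u(2), of "1 / k"] k by auto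
    with False show False
      unfolding solves_left_iff[OF \<theta>] by blast
  qed
  obtain y where y: "y < \<theta>" "{y<..\<theta>} \<subseteq> \<Theta>"
    using open_left[OF open_\<Theta> \<theta>, of "\<theta> - 1"] by auto
  then have u: "(y + \<theta>) / 2 \<in> \<Theta>" "(y + \<theta>) / 2 < \<theta>"
    by (auto simp: subset_eq)
  have "c \<le> ereal (deriv b w)" if w: "w \<in> \<Theta>" for w
  proof (cases "w < \<theta>")
    case True
    then show ?thesis by (rule below[OF w])
  next
    case False
    then have "deriv b ((y + \<theta>) / 2) \<le> deriv b w"
      using u w by (intro less_imp_le deriv_b_strict_mono) auto
    then have "ereal (deriv b ((y + \<theta>) / 2)) \<le> ereal (deriv b w)"
      by simp
    with below[OF u] show ?thesis
      by (rule order_trans)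
  qed
  then have "c \<le> mean_lower \<xi> b"
    unfolding mean_lower_def mean_range by (auto intro!: INF_greatest)
  with False show ?thesis
    by (simp add: mu_L_star_def)
qed

lemma solves_left_exists:
  assumes \<theta>: "\<theta> \<in> \<Theta>" and k: "k > 0"
    and m: "m \<in> mean_range \<xi> b" "m < deriv b \<theta>" "1 / k \<le> mean_div \<xi> b (deriv b \<theta>) m"
  shows "\<exists>!m. solves_left \<xi> b (deriv b \<theta>) k m"
proof -
  obtain u where u: "u \<in> \<Theta>" "m = deriv b u"
    using m(1) by (auto simp: mean_range)
  then have "u < \<theta>" "1 / k \<le> bregman \<theta> u"
    using m \<theta> by (auto simp: deriv_b_less_iff mean_div_eq_bregman)
  then obtain v where "v \<in> \<Theta>" "v < \<theta>" "bregman \<theta> v = 1 / k"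
    using bregman_attains[OF u(1) \<theta>, of "1 / k"] k by auto
  then have "\<exists>m. solves_left \<xi> b (deriv b \<theta>) k m"
    unfolding solves_left_iff[OF \<theta>] by blast
  then show ?thesis
    using solves_left_unique[OF \<theta>] by blast
qed

end

theorem corollary1:
  fixes \<xi> :: "real measure" and b :: "real \<Rightarrow> real" and \<nu> :: "real measure"
    and \<mu> :: real and N :: "real \<Rightarrow> nat" and L :: policy and \<mu>\<^sub>L :: ereal
  assumes "canonical_exp_family \<xi> b"
    and "\<nu> \<in> exp_family \<xi> b" and "\<mu> = mean \<nu>"
    and "filterlim N at_top (at_right 0)"
    and "L \<in> stable_CI_policies \<xi> b N \<nu>" and "stable_limit N \<nu> L \<mu>\<^sub>L"
  shows "(((\<lambda>\<delta>. real (N \<delta>) / ln (1 / \<delta>)) \<longlongrightarrow> 0) (at_right 0) \<longrightarrow>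
            converges_in_prob (sample_space \<nu>)
              (\<lambda>\<delta> \<omega>. ereal \<mu> - left_end L (N \<delta>) \<delta> \<omega>)
              (ereal \<mu> - mean_lower \<xi> b) (at_right 0))
       \<and> (\<forall>k>0. ((\<lambda>\<delta>. real (N \<delta>) / ln (1 / \<delta>)) \<longlongrightarrow> k) (at_right 0) \<longrightarrow>
            ((\<exists>m\<in>mean_range \<xi> b. m < \<mu> \<and> 1 / k \<le> mean_div \<xi> b \<mu> m) \<longrightarrow>
               (\<exists>!m. solves_left \<xi> b \<mu> k m)) \<and>
            ereal \<mu> - \<mu>\<^sub>L \<ge> ereal \<mu> - mu_L_star \<xi> b \<mu> k)"
proof -
  interpret canonical_family \<xi> b
    using assms(1) by unfold_locales
  obtain \<theta> where \<theta>: "\<theta> \<in> \<Theta>" and \<nu>: "\<nu> = P \<theta>"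
    using assms(2) by (auto simp: exp_family_def)
  have \<mu>: "\<mu> = deriv b \<theta>"
    using assms(3) \<nu> mean_P[OF \<theta>] by simp
  have policy: "one_sided_policy \<xi> b L" and cov: "covers \<xi> b L"
    using assms(5) by (auto simp: stable_CI_policies_def)
  have limit: "converges_in_prob (sample_space (P \<theta>)) (\<lambda>\<delta>. left_end L (N \<delta>) \<delta>) \<mu>\<^sub>L (at_right 0)"
    using assms(6) by (simp add: stable_limit_def \<nu>)
  have "\<forall>\<^sub>F \<delta> in at_right 0. N \<delta> \<ge> 1"
    using assms(4) by (simp add: filterlim_at_top)
  moreover have "\<forall>\<^sub>F \<delta>::real in at_right 0. 0 < \<delta> \<and> \<delta> < 1"
    by (auto simp: eventually_at_right_field intro: exI[of _ 1])
  ultimately have admissible: "\<forall>\<^sub>F \<delta> in at_right 0. N \<delta> \<ge> 1 \<and> 0 < \<delta> \<and> \<delta> < 1"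
    by eventually_elim auto
  have upper: "\<mu>\<^sub>L \<le> mu_L_star \<xi> b \<mu> k"
    if k: "k > 0" and rate: "((\<lambda>\<delta>. real (N \<delta>) / ln (1 / \<delta>)) \<longlongrightarrow> k) (at_right 0)" for k
    unfolding \<mu>
  proof (rule le_mu_L_star[OF \<theta> k])
    fix \<theta>' assume \<theta>': "\<theta>' \<in> \<Theta>" and "bregman \<theta> \<theta>' < 1 / k"
    then have "k * bregman \<theta> \<theta>' < 1"
      using k by (simp add: field_simps)
    then show "\<mu>\<^sub>L \<le> ereal (deriv b \<theta>')"
      by (rule stable_limit_le[OF \<theta> \<theta>' policy cov admissible rate limit])
  qed
  show ?thesis
  proof (intro conjI allI impI)
    assume "((\<lambda>\<delta>. real (N \<delta>) / ln (1 / \<delta>)) \<longlongrightarrow> 0) (at_right 0)"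
    then show "converges_in_prob (sample_space \<nu>) (\<lambda>\<delta> \<omega>. ereal \<mu> - left_end L (N \<delta>) \<delta> \<omega>)
        (ereal \<mu> - mean_lower \<xi> b) (at_right 0)"
      unfolding \<nu> by (rule no_learning[OF \<theta> policy cov admissible])
  next
    fix k :: real assume k: "k > 0"
    assume "\<exists>m\<in>mean_range \<xi> b. m < \<mu> \<and> 1 / k \<le> mean_div \<xi> b \<mu> m"
    then show "\<exists>!m. solves_left \<xi> b \<mu> k m"
      using solves_left_exists[OF \<theta> k] unfolding \<mu> by blast
  next
    fix k :: real assume "k > 0" and "((\<lambda>\<delta>. real (N \<delta>) / ln (1 / \<delta>)) \<longlongrightarrow> k) (at_right 0)"
    then show "ereal \<mu> - mu_L_star \<xi> b \<mu> k \<le> ereal \<mu> - \<mu>\<^sub>L"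
      by (intro ereal_minus_mono upper order_refl)
  qed
qed

end
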